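(* Let $\Gamma$ be the unit circle centered at the origin in $\mathbb{C}$, and let $a,b\in\mathbb{C}$ be points exterior to $\Gamma$. Alhazen's problem for $a,b$, namely to locate $z\in\Gamma$ such that the angle $\angle azb$ is bisected by the diameter of $\Gamma$ through $z$, can be solved by Euclidean tools and trisections; equivalently, by the origami constructions governed by axioms (P), (L), (E) and (T): starting from the points $0,1,a,b$, the solutions $z$ are constructible points under these axioms.
   Context: The plane is identified with $\mathbb{C}=\mathbb{R}^2$. The points and lines constructible from $0,1,a,b$ are the smallest collection of points and lines containing the points $0,1,a,b$ and closed under the following axioms. (L) The line connecting two distinct constructible points can be folded (is a constructible line). (P) The point of intersection of two distinct folded lines is a constructible point. (E) For a given folded line $l$ and distinct constructed points $P$ and $Q$, any line $l'$ through $Q$ with the property that the reflection of $P$ in $l'$ lies on $l$ can be folded (when such a line exists). (T) Given distinct constructed points $P$ and $Q$ and a constructed line $l$ through $P$, one can fold any line $l'$ with the property that the reflection of $Q$ in $l'$ lies on $l$ and the reflection of $P$ in $l'$ lies on the perpendicular bisector of the segment $PQ$. "Euclidean tools and trisections" means compass and straightedge together with the trisection of any angle between constructed lines. *)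

theory Defs
  imports "HOL-Analysis.Analysis"
begin

section \<open>Plane geometry in the complex plane\<close>

text \<open>Lines are represented as subsets of the plane.\<close>

definition is_line :: "complex set \<Rightarrow> bool" where
  "is_line l \<longleftrightarrow> (\<exists>A B. A \<noteq> B \<and> l = affine hull {A, B})"

text \<open>\<open>closest_point l P\<close> is the foot of the perpendicular from \<open>P\<close> to the line \<open>l\<close>, so it is
  the midpoint of \<open>P\<close> and its mirror image. Only meaningful if \<open>l\<close> is a line.\<close>

definition line_reflection :: "complex set \<Rightarrow> complex \<Rightarrow> complex" where
  "line_reflection l P = 2 * closest_point l P - P"

definition perp_bisector :: "complex \<Rightarrow> complex \<Rightarrow> complex set" where
  "perp_bisector P Q = {X. dist X P = dist X Q}"

text \<open>The directed angle at the vertex \<open>V\<close> from the ray \<open>VA\<close> to the ray \<open>VB\<close>,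
  normalised to \<open>(-\<pi>, \<pi>]\<close>.\<close>

definition directed_angle :: "complex \<Rightarrow> complex \<Rightarrow> complex \<Rightarrow> real" where
  "directed_angle A V B = Arg ((B - V) / (A - V))"

text \<open>The line \<open>d\<close> through \<open>V\<close> bisects the angle \<open>AVB\<close>. The angles are directed, so that \<open>A\<close> and
  \<open>B\<close> are mirror positions rather than on the same side of \<open>d\<close>. It does not matter which of the two
  rays of \<open>d\<close> the point \<open>W\<close> is taken from: replacing one by the other changes both angles by \<open>\<pi>\<close>.\<close>

definition bisects_angle :: "complex set \<Rightarrow> complex \<Rightarrow> complex \<Rightarrow> complex \<Rightarrow> bool" where
  "bisects_angle d A V B \<longleftrightarrow>
     is_line d \<and> V \<in> d \<and>
     (\<exists>W\<in>d. W \<noteq> V \<and> directed_angle A V W = directed_angle W V B)"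


section \<open>Alhazen's problem\<close>

text \<open>The diameter of the unit circle through \<open>z\<close> is taken as a full line.\<close>

definition alhazen_solution :: "complex \<Rightarrow> complex \<Rightarrow> complex \<Rightarrow> bool" where
  "alhazen_solution a b z \<longleftrightarrow>
     z \<in> sphere 0 1 \<and> bisects_angle (affine hull {0, z}) a z b"


section \<open>Origami constructions\<close>

inductive origami_point :: "complex set \<Rightarrow> complex \<Rightarrow> bool"
  and origami_line :: "complex set \<Rightarrow> complex set \<Rightarrow> bool"
  for S :: "complex set"
where
  origami_given: "P \<in> S \<Longrightarrow> origami_point S P"
| origami_L:
    "\<lbrakk>origami_point S P; origami_point S Q; P \<noteq> Q\<rbrakk>
     \<Longrightarrow> origami_line S (affine hull {P, Q})"
| origami_P:
    "\<lbrakk>origami_line S l; origami_line S m; l \<noteq> m; X \<in> l; X \<in> m\<rbrakk>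
     \<Longrightarrow> origami_point S X"
| origami_E:
    "\<lbrakk>origami_line S l; origami_point S P; origami_point S Q; P \<noteq> Q;
      is_line l'; Q \<in> l'; line_reflection l' P \<in> l\<rbrakk>
     \<Longrightarrow> origami_line S l'"
| origami_T:
    "\<lbrakk>origami_point S P; origami_point S Q; P \<noteq> Q; origami_line S l; P \<in> l;
      is_line l'; line_reflection l' Q \<in> l; line_reflection l' P \<in> perp_bisector P Q\<rbrakk>
     \<Longrightarrow> origami_line S l'"


section \<open>Compass, straightedge and angle trisection\<close>

text \<open>In the trisection rule the two given lines through \<open>V\<close> have directions \<open>cis \<alpha>\<close> and \<open>cis \<beta>\<close>;
  as \<open>\<alpha>\<close> is only determined by its line modulo \<open>\<pi>\<close>, the condition \<open>\<alpha> < \<beta> < \<alpha> + \<pi>\<close> covers all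
  the angles that the two lines form at \<open>V\<close>. It also forces the lines to be distinct, so that \<open>V\<close>
  is itself a constructible point.\<close>

inductive euclid_tri_point :: "complex set \<Rightarrow> complex \<Rightarrow> bool"
  and euclid_tri_line :: "complex set \<Rightarrow> complex set \<Rightarrow> bool"
  and euclid_tri_circle :: "complex set \<Rightarrow> complex set \<Rightarrow> bool"
  for S :: "complex set"
where
  euclid_tri_given: "P \<in> S \<Longrightarrow> euclid_tri_point S P"
| euclid_tri_straightedge:
    "\<lbrakk>euclid_tri_point S P; euclid_tri_point S Q; P \<noteq> Q\<rbrakk>
     \<Longrightarrow> euclid_tri_line S (affine hull {P, Q})"
| euclid_tri_compass:
    "\<lbrakk>euclid_tri_point S P; euclid_tri_point S Q; euclid_tri_point S R; Q \<noteq> R\<rbrakk>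
     \<Longrightarrow> euclid_tri_circle S (sphere P (dist Q R))"
| euclid_tri_line_line:
    "\<lbrakk>euclid_tri_line S l; euclid_tri_line S m; l \<noteq> m; X \<in> l; X \<in> m\<rbrakk>
     \<Longrightarrow> euclid_tri_point S X"
| euclid_tri_line_circle:
    "\<lbrakk>euclid_tri_line S l; euclid_tri_circle S c; X \<in> l; X \<in> c\<rbrakk>
     \<Longrightarrow> euclid_tri_point S X"
| euclid_tri_circle_circle:
    "\<lbrakk>euclid_tri_circle S c; euclid_tri_circle S d; c \<noteq> d; X \<in> c; X \<in> d\<rbrakk>
     \<Longrightarrow> euclid_tri_point S X"
| euclid_tri_trisect:
    "\<lbrakk>euclid_tri_line S (affine hull {V, V + cis \<alpha>});
      euclid_tri_line S (affine hull {V, V + cis \<beta>}); \<alpha> < \<beta>; \<beta> < \<alpha> + pi;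
      \<gamma> = \<alpha> + (\<beta> - \<alpha>) / 3 \<or> \<gamma> = \<alpha> + 2 * (\<beta> - \<alpha>) / 3\<rbrakk>
     \<Longrightarrow> euclid_tri_line S (affine hull {V, V + cis \<gamma>})"

end

theory Submission
  imports Defs
begin

text \<open>
  Since \<open>cnj z = 1 / z\<close> on the unit circle, the solutions \<open>z\<close> of Alhazen's problem are roots of a quartic
  \<open>cnj a * cnj b * z^4 - (cnj a + cnj b) * z^3 + (a + b) * z - a * b = 0\<close>. As \<open>a\<close> and \<open>b\<close> are exterior,
  the argument of \<open>(cnj a * z - 1) * (cnj b * z - 1)\<close> grows by \<open>4 * pi\<close> along the circle,
  which forces all four roots to be distinct and on the circle. Consequently the roots
  \<open>z1 * z2 + z3 * z4\<close> etc. of the resolvent cubic are, up to a common constructible factor, three real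
  numbers with sum zero. They are of the form \<open>2 * r * cos \<phi>\<close> with \<open>r\<close> and \<open>cos (3 * \<phi>)\<close>
  constructible, so an angle trisection yields them, and square roots do the rest.

  For both systems of construction rules it thus suffices to perform the field operations, square
  roots and the trisection of an angle at the origin.
\<close>

section \<open>Field operations, square roots and cubic equations\<close>

lemma affine_combination_mem_hull:
  fixes A B :: complex
  shows "X = A + of_real t * (B - A) \<Longrightarrow> X \<in> affine hull {A, B}"
  unfolding affine_hull_2
  by (rule CollectI, rule exI[of _ "1 - t"], rule exI[of _ t]) (simp add: scaleR_conv_of_real algebra_simps)

section \<open>Field operations by drawing lines\<close>

text \<open>Common interface of both systems of rules, so that the algebra is done only once. In
  \<open>meet\<close> the witness \<open>Y\<close> certifies that the two lines differ;
  \<open>coords\<close> reduces complex operations to real ones.\<close>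

locale line_constructions =
  fixes pt :: "complex \<Rightarrow> bool" and ln :: "complex set \<Rightarrow> bool"
  assumes pt_one: "pt 1"
    and line: "\<lbrakk>pt P; pt Q; P \<noteq> Q\<rbrakk> \<Longrightarrow> ln (affine hull {P, Q})"
    and meet: "\<lbrakk>ln l; ln m; X \<in> l; X \<in> m; Y \<in> l; Y \<notin> m\<rbrakk> \<Longrightarrow> pt X"
    and coords: "pt (Complex x y) \<longleftrightarrow> pt (of_real x) \<and> pt (of_real y)"
    and real_add: "\<lbrakk>pt (of_real x); pt (of_real y)\<rbrakk> \<Longrightarrow> pt (of_real (x + y))"
    and real_minus: "pt (of_real x) \<Longrightarrow> pt (of_real (- x))"
begin

lemma pt_iff: "pt z \<longleftrightarrow> pt (of_real (Re z)) \<and> pt (of_real (Im z))"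
  using coords[of "Re z" "Im z"] by simp

lemma pt_zero: "pt 0"
  using real_add[of 1 "-1"] real_minus[of 1] pt_one by simp

lemma pt_add: "pt w \<Longrightarrow> pt z \<Longrightarrow> pt (w + z)"
  using real_add by (subst (asm) (1 2) pt_iff, subst pt_iff) auto

lemma pt_minus: "pt z \<Longrightarrow> pt (- z)"
  using real_minus by (subst (asm) pt_iff, subst pt_iff) auto

lemma pt_diff: "pt w \<Longrightarrow> pt z \<Longrightarrow> pt (w - z)"
  using pt_add[of w "- z"] pt_minus by simp

lemma pt_cnj: "pt z \<Longrightarrow> pt (cnj z)"
  using real_minus by (subst (asm) pt_iff, subst pt_iff) auto

lemma pt_ii: "pt \<i>"
  using pt_zero pt_one by (subst pt_iff) auto

text \<open>Similar triangles: the line through \<open>(0, y)\<close> with direction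
  \<open>(x, -1)\<close> meets the real axis at \<open>x * y\<close>. The height difference 1 keeps
  \<open>?A\<close> and \<open>?B\<close> distinct for every \<open>x\<close>; for
  \<open>y = 0\<close> the point \<open>?A\<close> lies on the real axis itself, so this case is
  settled apart.\<close>

lemma real_mult:
  assumes "pt (of_real x)" "pt (of_real y)"
  shows "pt (of_real (x * y))"
proof (cases "y = 0")
  case False
  let ?A = "\<i> * of_real y" and ?B = "of_real x + \<i> * of_real (y - 1)"
  have "pt ?A" "pt ?B"
    using assms pt_zero pt_one real_add[of y "-1"] real_minus[of 1] by (subst pt_iff; simp)+
  moreover have "?A \<noteq> ?B"
    by (simp add: complex_eq_iff)
  ultimately have *: "ln (affine hull {?A, ?B})"
    by (rule line)
  have re: "Im X = 0" if "X \<in> affine hull {0, 1}" for X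
    using that by (auto simp: affine_hull_2)
  show ?thesis
  proof (rule meet[OF * line[OF pt_zero pt_one]])
    show "of_real (x * y) \<in> affine hull {?A, ?B}"
      by (rule affine_combination_mem_hull[of _ _ y]) (simp add: complex_eq_iff algebra_simps)
    show "of_real (x * y) \<in> affine hull {0, 1 :: complex}"
      by (rule affine_combination_mem_hull[of _ _ "x * y"]) (simp del: of_real_mult)
    show "?A \<in> affine hull {?A, ?B}"
      by (simp add: hull_inc)
    show "?A \<notin> affine hull {0, 1}"
      using re[of ?A] False by auto
  qed simp
qed (simp add: pt_zero)

lemma real_diff: "\<lbrakk>pt (of_real x); pt (of_real y)\<rbrakk> \<Longrightarrow> pt (of_real (x - y))"
  using real_add[of x "- y"] real_minus[of y] by simp

lemma pt_mult:
  assumes "pt w" "pt z"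
  shows "pt (w * z)"
proof -
  note parts = assms[THEN iffD1[OF pt_iff], THEN conjunct1] assms[THEN iffD1[OF pt_iff], THEN conjunct2]
  have "pt (of_real (Re (w * z)))" "pt (of_real (Im (w * z)))"
    unfolding times_complex.sel by (intro real_add real_diff real_mult parts)+
  then show ?thesis
    using pt_iff by blast
qed

text \<open>The line from \<open>1\<close> with direction \<open>- x + \<i>\<close> meets the
  imaginary axis at \<open>\<i> / x\<close>, and \<open>coords\<close> carries this over to the real
  axis. The convention \<open>inverse 0 = 0\<close> covers the remaining case.\<close>

lemma real_inverse:
  assumes "pt (of_real x)"
  shows "pt (of_real (inverse x))"
proof (cases "x = 0")
  case False
  let ?B = "1 - of_real x + \<i>"
  have "pt ?B"
    using assms pt_add pt_diff pt_one pt_ii by auto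
  moreover have "1 \<noteq> ?B"
    by (simp add: complex_eq_iff)
  ultimately have *: "ln (affine hull {1, ?B})"
    by (intro line pt_one) auto
  have im: "Re X = 0" if "X \<in> affine hull {0, \<i>}" for X
    using that by (auto simp: affine_hull_2)
  have "pt (\<i> * of_real (inverse x))"
  proof (rule meet[OF * line[OF pt_zero pt_ii]])
    show "\<i> * of_real (inverse x) \<in> affine hull {1, ?B}"
      by (rule affine_combination_mem_hull[of _ _ "inverse x"])
        (use False in \<open>simp add: complex_eq_iff algebra_simps\<close>)
    show "\<i> * of_real (inverse x) \<in> affine hull {0, \<i>}"
      by (rule affine_combination_mem_hull[of _ _ "inverse x"]) simp
    show "1 \<in> affine hull {1, ?B}"
      by (simp add: hull_inc)
    show "1 \<notin> affine hull {0, \<i>}"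
      using im[of 1] by auto
  qed simp
  then show ?thesis
    using coords[of 0 "inverse x"] by (simp add: Complex_eq)
qed (simp add: pt_zero)

lemma pt_inverse: "pt z \<Longrightarrow> pt (inverse z)"
proof -
  assume z: "pt z"
  have "inverse z = cnj z * of_real (inverse ((Re z)\<^sup>2 + (Im z)\<^sup>2))"
    by (simp add: complex_eq_iff divide_inverse del: of_real_inverse)
  moreover have "pt (of_real (inverse ((Re z)\<^sup>2 + (Im z)\<^sup>2)))"
    using z[THEN iffD1[OF pt_iff]] unfolding power2_eq_square
    by (intro real_inverse real_add real_mult) simp_all
  ultimately show ?thesis
    using pt_mult[OF pt_cnj[OF z]] by simp
qed

lemma pt_divide: "pt w \<Longrightarrow> pt z \<Longrightarrow> pt (w / z)"
  by (simp add: divide_inverse pt_mult pt_inverse)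

lemma pt_of_nat: "pt (of_nat n)"
  by (induction n) (auto intro: pt_zero pt_one pt_add)

lemma pt_numeral: "pt (numeral k)"
  using pt_of_nat[of "numeral k"] by simp

lemma pt_power: "pt z \<Longrightarrow> pt (z ^ n)"
  by (induction n) (auto intro: pt_one pt_mult)

lemmas pt_field = pt_zero pt_one pt_add pt_minus pt_diff pt_mult pt_inverse pt_divide
  pt_numeral pt_power pt_ii pt_cnj

end

section \<open>Square roots, cubics and quartics from angle trisection\<close>

text \<open>On the unit circle trisecting an angle means taking a cube root; \<open>trisect\<close>
  asks for every cube root of \<open>w ^ 3\<close>.\<close>

locale trisection_constructions = line_constructions +
  assumes real_sqrt: "\<lbrakk>pt (of_real x); 0 < x\<rbrakk> \<Longrightarrow> pt (of_real (sqrt x))"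
    and trisect: "\<lbrakk>norm w = 1; pt (w ^ 3)\<rbrakk> \<Longrightarrow> pt w"
begin

lemma real_sqrt': "\<lbrakk>pt (of_real x); 0 \<le> x\<rbrakk> \<Longrightarrow> pt (of_real (sqrt x))"
  using real_sqrt[of x] pt_zero by (cases "x = 0") auto

lemma pt_csqrt:
  assumes "pt z"
  shows "pt (csqrt z)"
proof -
  have re: "pt (of_real (Re z))" and im: "pt (of_real (Im z))"
    using assms pt_iff[of z] by blast+
  have n: "pt (of_real (cmod z))"
    using real_sqrt'[OF real_add[OF real_mult[OF re re] real_mult[OF im im]]]
    by (simp add: cmod_def power2_eq_square)
  have s: "pt (of_real (sgn (Im z)))"
    by (simp add: sgn_if pt_zero pt_one pt_minus)
  have two: "pt (of_real 2)"
    using pt_numeral by simp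
  have half: "pt (of_real (sqrt (x / 2)))" if "pt (of_real x)" "0 \<le> x" for x
    using that two by (intro real_sqrt') (simp_all add: pt_divide)
  \<comment> \<open>Half-angle formulas: up to sign these are the real and imaginary parts of
    \<open>csqrt z\<close>.\<close>
  have "pt (of_real (sqrt ((cmod z + Re z) / 2)))" "pt (of_real (sqrt ((cmod z - Re z) / 2)))"
    using half[of "cmod z + Re z"] half[of "cmod z - Re z"] re n abs_Re_le_cmod[of z]
    by (simp_all add: pt_add pt_diff)
  then show ?thesis
    using s by (subst pt_iff) (simp add: real_mult pt_mult pt_minus)
qed

lemma pt_square_root: "pt (w\<^sup>2) \<Longrightarrow> pt w"
proof -
  assume "pt (w\<^sup>2)"
  then have "pt (csqrt (w\<^sup>2))"
    by (rule pt_csqrt)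
  moreover have "w = csqrt (w\<^sup>2) \<or> w = - csqrt (w\<^sup>2)"
    by (metis power2_csqrt power2_eq_iff)
  ultimately show ?thesis
    using pt_minus by metis
qed

lemma pt_quadratic:
  assumes "pt (p + q)" "pt (p * q)"
  shows "pt p"
proof -
  have "(p - q)\<^sup>2 = (p + q)\<^sup>2 - 4 * (p * q)"
    by (simp add: power2_eq_square algebra_simps)
  then have "pt (p - q)"
    using assms by (metis pt_square_root pt_diff pt_power pt_mult pt_numeral)
  moreover have "p = ((p + q) + (p - q)) / 2"
    by simp
  ultimately show ?thesis
    using assms(1) pt_field by metis
qed

text \<open>Viete's trigonometric solution for three real roots: with
  \<open>t = 2 * r * cos f\<close> and \<open>3 * r\<^sup>2 = p\<close>, the identity for
  \<open>cos (3 * f)\<close> turns the cubic equation into a formula for \<open>cos (3 * f)\<close>,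
  and trisecting \<open>3 * f\<close> returns \<open>cos f\<close>.\<close>

lemma pt_depressed_cubic:
  fixes t u v :: real
  assumes sum: "t + u + v = 0"
    and p: "pt (of_real (t * u + t * v + u * v))" and q: "pt (of_real (t * u * v))"
  shows "pt (of_real t)"
proof -
  define p where "p = - (t * u + t * v + u * v)"
  define r where "r = sqrt (p / 3)"
  have v: "v = - t - u"
    using sum by simp
  have p_eq: "p = t\<^sup>2 + t * u + u\<^sup>2"
    by (simp add: p_def v power2_eq_square algebra_simps)
  \<comment> \<open>Since \<open>t + 2 * u = u - v\<close>, this is the discriminant of the
    quadratic with roots \<open>u\<close> and \<open>v\<close>. Its sign gives \<open>p > 0\<close>
    for nonzero \<open>t\<close> and later puts \<open>t / (2 * r)\<close> into the domain of
    \<open>arccos\<close>.\<close>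
  have "4 * p - 3 * t\<^sup>2 = (t + 2 * u)\<^sup>2"
    by (simp add: p_eq power2_eq_square algebra_simps)
  then have tp: "3 * t\<^sup>2 \<le> 4 * p"
    using zero_le_power2[of "t + 2 * u"] by linarith
  show ?thesis
  proof (cases "t = 0")
    case False
    then have p0: "p > 0"
      using tp zero_less_power2[of t] by linarith
    then have r0: "r > 0" and r2: "3 * r\<^sup>2 = p"
      by (auto simp: r_def)
    have ptp: "pt (of_real (p / 3))"
      using pt_divide[OF pt_minus[OF p] pt_numeral] unfolding p_def
      by (simp only: of_real_minus of_real_divide of_real_numeral)
    have ptr: "pt (of_real r)"
      unfolding r_def using p0 ptp by (intro real_sqrt) auto
    have "t\<^sup>2 \<le> (2 * r)\<^sup>2"
      using tp r2 by (simp add: power_mult_distrib)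
    then have "\<bar>t\<bar> \<le> 2 * r"
      using r0 abs_le_square_iff[of t "2 * r"] by simp
    then have bound: "-1 \<le> t / (2 * r)" "t / (2 * r) \<le> 1"
      using r0 by (auto simp: field_simps)
    define f where "f = arccos (t / (2 * r))"
    have t: "t = 2 * r * cos f"
      using bound r0 by (simp add: f_def)
    have cos3: "cos (3 * f) = (t * u * v) / (2 * r ^ 3)"
    proof -
      have "t * u * v = t ^ 3 - p * t"
        by (simp add: p_eq v power2_eq_square power3_eq_cube algebra_simps)
      also have "\<dots> = 2 * r ^ 3 * (4 * cos f ^ 3 - 3 * cos f)"
        by (simp add: r2[symmetric] t power2_eq_square power3_eq_cube algebra_simps)
      also have "\<dots> = 2 * r ^ 3 * cos (3 * f)"
        by (simp add: cos_treble_cos)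
      finally show ?thesis
        using r0 by simp
    qed
    have c: "pt (of_real (cos (3 * f)))"
      unfolding cos3 of_real_divide[where x = "t * u * v"] using q ptr
      by (simp only: of_real_mult[of 2] of_real_power of_real_numeral pt_field)
    have "(of_real (sin (3 * f)) :: complex)\<^sup>2 = 1 - (of_real (cos (3 * f)))\<^sup>2"
      by (metis of_real_1 of_real_diff of_real_power sin_squared_eq)
    moreover have "pt (1 - (of_real (cos (3 * f)))\<^sup>2)"
      using c by (simp only: pt_field)
    ultimately have "pt (of_real (sin (3 * f)))"
      using pt_square_root by metis
    with c have "pt (cis (3 * f))"
      by (subst pt_iff) simp
    then have "pt (cis f)"
      using trisect[of "cis f"] by (simp add: Complex.DeMoivre)
    then have "pt (of_real (cos f))"
      by (subst (asm) pt_iff) simp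
    then show ?thesis
      using ptr by (simp only: t of_real_mult of_real_numeral pt_field)
  qed (simp add: pt_zero)
qed

text \<open>For roots on the unit circle, \<open>cnj z = 1 / z\<close>, so the roots of the resolvent cubic become
  real after division by a square root of the product of the four roots.\<close>

lemma pt_unit_quartic:
  assumes unit: "norm z1 = 1" "norm z2 = 1" "norm z3 = 1" "norm z4 = 1"
    and e1: "pt (z1 + z2 + z3 + z4)"
    and e2: "z1 * z2 + z1 * z3 + z1 * z4 + z2 * z3 + z2 * z4 + z3 * z4 = 0"
    and e3: "pt (z1 * z2 * z3 + z1 * z2 * z4 + z1 * z3 * z4 + z2 * z3 * z4)"
    and e4: "pt (z1 * z2 * z3 * z4)"
  shows "pt z1"
proof -
  let ?e1 = "z1 + z2 + z3 + z4"
  let ?e3 = "z1 * z2 * z3 + z1 * z2 * z4 + z1 * z3 * z4 + z2 * z3 * z4"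
  let ?e4 = "z1 * z2 * z3 * z4"
  define w where "w = csqrt ?e4"
  have w2: "w * w = ?e4"
    by (simp add: w_def flip: power2_eq_square)
  have "(cmod w)\<^sup>2 = 1"
    using unit w2 by (metis mult_1 norm_mult power2_eq_square)
  then have unit_w: "cmod w = 1"
    by (simp add: power2_eq_1_iff) (use norm_ge_zero[of w] in linarith)
  have ptw: "pt w"
    unfolding w_def using e4 by (rule pt_csqrt)
  have nz: "z1 \<noteq> 0" "z2 \<noteq> 0" "z3 \<noteq> 0" "z4 \<noteq> 0" "w \<noteq> 0"
    using unit unit_w by auto
  have cnj_unit: "cnj x = 1 / x" if "cmod x = 1" for x
    using that complex_norm_square[of x] by (subst eq_divide_eq) (auto simp: mult.commute)
  \<comment> \<open>Conjugation inverts each unimodular factor; by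
    \<open>x * y * x' * y' = w * w\<close> the quotient then returns to itself.\<close>
  have real: "\<exists>t. (x * y + x' * y') / w = of_real t"
    if "cmod x = 1" "cmod y = 1" "cmod x' = 1" "cmod y' = 1" "x * y * x' * y' = w * w" for x y x' y'
  proof -
    have nz': "x \<noteq> 0" "y \<noteq> 0" "x' \<noteq> 0" "y' \<noteq> 0"
      using that by auto
    have "cnj ((x * y + x' * y') / w) = (1 / (x * y) + 1 / (x' * y')) * w"
      using that unit_w by (simp add: cnj_unit)
    also have "\<dots> = (x * y + x' * y') * w / (x * y * x' * y')"
      using nz' by (simp add: field_simps)
    also have "\<dots> = (x * y + x' * y') / w"
      using nz by (simp add: that)
    finally show ?thesis
      by (metis Reals_cases Reals_cnj_iff)
  qed
  obtain t where t: "(z1 * z2 + z3 * z4) / w = of_real t"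
    using real[of z1 z2 z3 z4, OF unit(1) unit(2) unit(3) unit(4)] w2 by (metis mult.assoc mult.commute)
  obtain u where u: "(z1 * z3 + z2 * z4) / w = of_real u"
    using real[of z1 z3 z2 z4, OF unit(1) unit(3) unit(2) unit(4)] w2 by (metis mult.assoc mult.commute)
  obtain v where v: "(z1 * z4 + z2 * z3) / w = of_real v"
    using real[of z1 z4 z2 z3, OF unit(1) unit(4) unit(2) unit(3)] w2 by (metis mult.assoc mult.commute)
  \<comment> \<open>The resolvent cubic is depressed because the second elementary symmetric
    function vanishes.\<close>
  have "complex_of_real (t + u + v) = 0"
    using e2 by (simp add: t[symmetric] u[symmetric] v[symmetric] ac_simps flip: add_divide_distrib)
  then have sum: "t + u + v = 0"
    using of_real_eq_0_iff by blast
  \<comment> \<open>The other two coefficients of the resolvent cubic, here and in the triple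
    product below, are polynomials in the elementary symmetric functions.\<close>
  have "(z1 * z2 + z3 * z4) * (z1 * z3 + z2 * z4) + (z1 * z2 + z3 * z4) * (z1 * z4 + z2 * z3)
      + (z1 * z3 + z2 * z4) * (z1 * z4 + z2 * z3) = ?e1 * ?e3 - 4 * ?e4"
    by algebra
  then have "complex_of_real (t * u + t * v + u * v) = (?e1 * ?e3 - 4 * ?e4) / w\<^sup>2"
    by (simp only: of_real_add of_real_mult t[symmetric] u[symmetric] v[symmetric]
      times_divide_times_eq add_divide_distrib[symmetric] power2_eq_square)
  moreover have "pt \<dots>"
    using e1 e3 e4 ptw by (simp only: pt_field)
  ultimately have p: "pt (of_real (t * u + t * v + u * v))"
    by simp
  have "(z1 * z2 + z3 * z4) * (z1 * z3 + z2 * z4) * (z1 * z4 + z2 * z3)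
      = ?e3\<^sup>2 + ?e1\<^sup>2 * ?e4 - 4 * (z1 * z2 + z1 * z3 + z1 * z4 + z2 * z3 + z2 * z4 + z3 * z4) * ?e4"
    by algebra
  then have "(z1 * z2 + z3 * z4) * (z1 * z3 + z2 * z4) * (z1 * z4 + z2 * z3) = ?e3\<^sup>2 + ?e1\<^sup>2 * ?e4"
    by (simp add: e2)
  then have "complex_of_real (t * u * v) = (?e3\<^sup>2 + ?e1\<^sup>2 * ?e4) / w ^ 3"
    by (simp only: of_real_mult t[symmetric] u[symmetric] v[symmetric] times_divide_times_eq power3_eq_cube)
  moreover have "pt \<dots>"
    using e1 e3 e4 ptw by (simp only: pt_field)
  ultimately have "pt (of_real (t * u * v))"
    by simp
  with sum p have "pt (of_real t)"
    by (rule pt_depressed_cubic)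
  then have "pt ((z1 * z2 + z3 * z4) / w * w)"
    using ptw by (simp only: t pt_mult)
  then have uu: "pt (z1 * z2 + z3 * z4)"
    using nz by simp
  \<comment> \<open>Three quadratics lead from one resolvent root down to \<open>z1\<close>: first
    \<open>z1 * z2\<close> and \<open>z3 * z4\<close> with product \<open>?e4\<close>, then
    \<open>z1 + z2\<close> and \<open>z3 + z4\<close>, whose product is minus the resolvent root,
    then \<open>z1\<close> and \<open>z2\<close>.\<close>
  then have z12: "pt (z1 * z2)"
    by (rule pt_quadratic) (use e4 in \<open>simp add: mult.assoc\<close>)
  have "(z1 + z2) * (z3 + z4) = - (z1 * z2 + z3 * z4)"
    using e2 by algebra
  then have "pt ((z1 + z2) * (z3 + z4))"
    using pt_minus[OF uu] by (simp only:)
  moreover have "pt ((z1 + z2) + (z3 + z4))"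
    using e1 by (simp only: add.assoc)
  ultimately have "pt (z1 + z2)"
    by (metis pt_quadratic)
  then show ?thesis
    using z12 by (rule pt_quadratic)
qed

end

section \<open>The quartic equation\<close>

text \<open>Subtracting \<open>k4\<close> times the product of the four linear factors cancels the
  terms of degree four. What remains, \<open>d\<close>, has degree at most three and four distinct
  roots, so all its coefficients vanish.\<close>

lemma vieta_quartic:
  fixes z1 z2 z3 z4 :: "'a :: {idom, ring_char_0}"
  assumes root: "\<forall>x\<in>{z1, z2, z3, z4}. k4 * x ^ 4 + k3 * x ^ 3 + k2 * x\<^sup>2 + k1 * x + k0 = 0"
    and "distinct [z1, z2, z3, z4]"
  shows "k4 * (z1 + z2 + z3 + z4) = - k3"
    and "k4 * (z1 * z2 + z1 * z3 + z1 * z4 + z2 * z3 + z2 * z4 + z3 * z4) = k2"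
    and "k4 * (z1 * z2 * z3 + z1 * z2 * z4 + z1 * z3 * z4 + z2 * z3 * z4) = - k1"
    and "k4 * (z1 * z2 * z3 * z4) = k0"
proof -
  let ?e1 = "z1 + z2 + z3 + z4"
  let ?e2 = "z1 * z2 + z1 * z3 + z1 * z4 + z2 * z3 + z2 * z4 + z3 * z4"
  let ?e3 = "z1 * z2 * z3 + z1 * z2 * z4 + z1 * z3 * z4 + z2 * z3 * z4"
  let ?e4 = "z1 * z2 * z3 * z4"
  define d where "d = [:k0 - k4 * ?e4, k1 + k4 * ?e3, k2 - k4 * ?e2, k3 + k4 * ?e1:]"
  have "poly d x = (k4 * x ^ 4 + k3 * x ^ 3 + k2 * x\<^sup>2 + k1 * x + k0)
      - k4 * ((x - z1) * (x - z2) * (x - z3) * (x - z4))" for x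
    unfolding d_def by (simp, algebra)
  then have sub: "{z1, z2, z3, z4} \<subseteq> {x. poly d x = 0}"
    using root by auto
  have "d = 0"
  proof (rule ccontr)
    assume "d \<noteq> 0"
    then have "card {x. poly d x = 0} \<le> degree d"
      by (rule card_poly_roots_bound)
    moreover have "degree d \<le> 3"
      unfolding d_def by simp
    moreover have "card {z1, z2, z3, z4} \<le> card {x. poly d x = 0}"
      using sub \<open>d \<noteq> 0\<close> by (intro card_mono poly_roots_finite)
    ultimately show False
      using assms(2) by simp
  qed
  then have "k3 + k4 * ?e1 = 0 \<and> k2 - k4 * ?e2 = 0 \<and> k1 + k4 * ?e3 = 0 \<and> k0 - k4 * ?e4 = 0"
    by (simp only: d_def pCons_eq_0_iff)
  then show "k4 * ?e1 = - k3" "k4 * ?e2 = k2" "k4 * ?e3 = - k1" "k4 * ?e4 = k0"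
    by (simp_all add: eq_neg_iff_add_eq_0 add.commute)
qed

section \<open>Four roots on the unit circle\<close>

text \<open>Factoring out \<open>cnj c * cis \<theta>\<close> leaves \<open>h \<theta>\<close> at
  distance less than 1 from 1, hence in the right half plane. There \<open>Arg\<close> is
  continuous, and as \<open>h\<close> is periodic, only the summand \<theta> contributes to the
  growth by \<open>2 * pi\<close>.\<close>

lemma continuous_phase:
  assumes "1 < cmod c"
  obtains g where "continuous_on UNIV g" "\<And>\<theta>. g (\<theta> + 2 * pi) = g \<theta> + 2 * pi"
    "\<And>\<theta>. cnj c * cis \<theta> - 1 = of_real (cmod (cnj c * cis \<theta> - 1)) * cis (g \<theta>)"
proof
  define h where "h \<theta> = 1 - cis (- \<theta>) / cnj c" for \<theta>
  define g where "g \<theta> = Arg (cnj c) + \<theta> + Arg (h \<theta>)" for \<theta>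
  have "h \<theta> \<notin> \<real>\<^sub>\<le>\<^sub>0" for \<theta>
  proof -
    have "\<bar>Re (cis (- \<theta>) / cnj c)\<bar> \<le> cmod (cis (- \<theta>) / cnj c)"
      by (rule abs_Re_le_cmod)
    also have "\<dots> < 1"
      using assms by (simp add: norm_divide divide_less_eq)
    finally have "Re (h \<theta>) > 0"
      by (simp add: h_def)
    then show ?thesis
      using complex_nonpos_Reals_iff by auto
  qed
  moreover have "continuous_on UNIV h"
    unfolding h_def using assms by (intro continuous_intros) auto
  ultimately show "continuous_on UNIV g"
    unfolding g_def by (intro continuous_intros continuous_on_Arg') auto
  show "g (\<theta> + 2 * pi) = g \<theta> + 2 * pi" for \<theta>
    by (simp add: g_def h_def flip: cis_divide)
  fix \<theta>
  have eq: "cnj c * cis \<theta> - 1 = cnj c * cis \<theta> * h \<theta>"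
    using assms by (auto simp: h_def field_simps cis_mult)
  have "cis (g \<theta>) = cis (Arg (cnj c)) * cis \<theta> * cis (Arg (h \<theta>))"
    by (simp add: g_def cis_mult)
  then have "of_real (cmod (cnj c * cis \<theta> * h \<theta>)) * cis (g \<theta>)
     = rcis (cmod (cnj c)) (Arg (cnj c)) * cis \<theta> * rcis (cmod (h \<theta>)) (Arg (h \<theta>))"
    by (simp add: norm_mult rcis_def)
  then show "cnj c * cis \<theta> - 1 = of_real (cmod (cnj c * cis \<theta> - 1)) * cis (g \<theta>)"
    unfolding eq by (simp only: rcis_cmod_Arg)
qed

text \<open>As \<open>z\<close> runs once around the unit circle, the argument of \<open>(cnj a * z - 1) * (cnj b * z - 1)\<close>
  grows by \<open>4 * pi\<close>, so it passes four multiples of \<open>pi\<close>. This needs both points to be exterior.\<close>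

lemma four_roots_on_unit_circle:
  assumes "1 < cmod a" "1 < cmod b"
  obtains A where "A \<subseteq> sphere 0 1" "card A = 4"
    "\<And>z. z \<in> A \<Longrightarrow> Im ((cnj a * z - 1) * (cnj b * z - 1)) = 0"
proof -
  obtain g where g: "continuous_on UNIV g" "\<And>\<theta>. g (\<theta> + 2 * pi) = g \<theta> + 2 * pi"
    "\<And>\<theta>. cnj a * cis \<theta> - 1 = of_real (cmod (cnj a * cis \<theta> - 1)) * cis (g \<theta>)"
    using continuous_phase[OF assms(1)] by blast
  obtain h where h: "continuous_on UNIV h" "\<And>\<theta>. h (\<theta> + 2 * pi) = h \<theta> + 2 * pi"
    "\<And>\<theta>. cnj b * cis \<theta> - 1 = of_real (cmod (cnj b * cis \<theta> - 1)) * cis (h \<theta>)"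
    using continuous_phase[OF assms(2)] by blast
  define f where "f \<theta> = g \<theta> + h \<theta>" for \<theta>
  \<comment> \<open>The least integer with \<open>f 0 \<le> m * pi\<close>, so that the four
    multiples from \<open>m * pi\<close> to \<open>(m + 3) * pi\<close> lie between
    \<open>f 0\<close> and \<open>f 0 + 4 * pi\<close>, the latter excluded.\<close>
  define m where "m = \<lceil>f 0 / pi\<rceil>"
  have m: "f 0 \<le> m * pi" "m * pi < f 0 + pi"
  proof -
    have "f 0 / pi \<le> m" "m < f 0 / pi + 1"
      using ceiling_correct[of "f 0 / pi"] by (auto simp: m_def)
    then show "f 0 \<le> m * pi" "m * pi < f 0 + pi"
      by (simp_all add: field_simps)
  qed
  have period: "f (2 * pi) = f 0 + 4 * pi"
    using g(2)[of 0] h(2)[of 0] by (simp add: f_def)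
  have "\<exists>\<theta>\<ge>0. \<theta> < 2 * pi \<and> f \<theta> = (m + int j) * pi" if "j < 4" for j :: nat
  proof -
    have j: "0 \<le> j * pi" "j * pi \<le> 3 * pi"
      using that by (simp_all add: mult_right_mono)
    have shift: "(m + int j) * pi = m * pi + j * pi"
      by (simp add: algebra_simps)
    have upper: "(m + int j) * pi < f (2 * pi)"
      unfolding period shift using m j by linarith
    have "\<exists>\<theta>\<ge>0. \<theta> \<le> 2 * pi \<and> f \<theta> = (m + int j) * pi"
    proof (rule IVT')
      show "continuous_on {0..2 * pi} f"
        unfolding f_def
        by (intro continuous_intros continuous_on_subset[OF g(1)] continuous_on_subset[OF h(1)]) auto
      show "f 0 \<le> (m + int j) * pi"
        unfolding shift using m j by linarith
    qed (use upper in auto)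
    \<comment> \<open>The strict bound \<open>upper\<close> excludes \<theta> =
      \<open>2 * pi\<close>, which keeps all angles in a range where \<open>cis\<close> is
      injective.\<close>
    then show ?thesis
      using upper by (metis less_eq_real_def less_irrefl)
  qed
  then have "\<forall>j\<in>{..<4}. \<exists>t. 0 \<le> t \<and> t < 2 * pi \<and> f t = (m + int j) * pi"
    by blast
  then obtain \<theta> where "\<forall>j\<in>{..<4}. 0 \<le> \<theta> j \<and> \<theta> j < 2 * pi \<and> f (\<theta> j) = (m + int j) * pi"
    by (rule bchoice[elim_format]) blast
  then have \<theta>: "0 \<le> \<theta> j" "\<theta> j < 2 * pi" "f (\<theta> j) = (m + int j) * pi" if "j < 4" for j
    using that by auto
  have Arg2pi_cis: "Arg2pi (cis (\<theta> j)) = \<theta> j" if "j < 4" for j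
    using \<theta>[OF that] by (intro Arg2pi_unique[of 1]) (simp_all add: cis_conv_exp)
  have "inj_on (\<lambda>j. cis (\<theta> j)) {..<4}"
  proof (rule inj_onI)
    fix i j :: nat
    assume ij: "i \<in> {..<4}" "j \<in> {..<4}" and eq: "cis (\<theta> i) = cis (\<theta> j)"
    note ij = ij[THEN lessThan_iff[THEN iffD1]]
    have "\<theta> i = \<theta> j"
      using Arg2pi_cis[OF ij(1)] Arg2pi_cis[OF ij(2)] unfolding eq by (rule trans[OF sym])
    then have "(m + int i) * pi = (m + int j) * pi"
      using \<theta>(3)[OF ij(1)] \<theta>(3)[OF ij(2)] by metis
    then show "i = j"
      by simp
  qed
  then have card: "card ((\<lambda>j. cis (\<theta> j)) ` {..<4}) = 4"
    by (simp add: card_image)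
  have "Im ((cnj a * cis (\<theta> j) - 1) * (cnj b * cis (\<theta> j) - 1)) = 0" if "j < 4" for j
  proof -
    define r where "r = cmod (cnj a * cis (\<theta> j) - 1)"
    define s where "s = cmod (cnj b * cis (\<theta> j) - 1)"
    have "(cnj a * cis (\<theta> j) - 1) * (cnj b * cis (\<theta> j) - 1)
        = (of_real r * cis (g (\<theta> j))) * (of_real s * cis (h (\<theta> j)))"
      unfolding r_def s_def by (intro arg_cong2[where f = "(*)"] g(3) h(3))
    also have "\<dots> = of_real (r * s) * cis (f (\<theta> j))"
      by (simp add: f_def flip: cis_mult)
    finally have "(cnj a * cis (\<theta> j) - 1) * (cnj b * cis (\<theta> j) - 1) = of_real (r * s) * cis (f (\<theta> j))" .
    moreover have "sin (f (\<theta> j)) = 0"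
      unfolding \<theta>(3)[OF that] using sin_zero_iff_int2 by blast
    ultimately show ?thesis
      by (simp only: times_complex.sel cis.sel Im_complex_of_real mult_zero_right mult_zero_left add_0_right)
  qed
  with card show ?thesis
    by (intro that[of "(\<lambda>j. cis (\<theta> j)) ` {..<4}"]) auto
qed

section \<open>From the bisected angle to the quartic\<close>

text \<open>A number is real iff it equals its conjugate; multiplying that equation by
  \<open>z\<^sup>2\<close> clears \<open>cnj z = 1 / z\<close>. The polynomial keeps its zero
  coefficient and the signs inside so as to match \<open>vieta_quartic\<close>.\<close>

lemma unit_circle_quartic:
  assumes "cmod z = 1"
  shows "Im ((cnj a * z - 1) * (cnj b * z - 1)) = 0 \<longleftrightarrow>
    cnj a * cnj b * z ^ 4 + - (cnj a + cnj b) * z ^ 3 + 0 * z\<^sup>2 + (a + b) * z + - (a * b) = 0"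
proof -
  let ?w = "(cnj a * z - 1) * (cnj b * z - 1)"
  have z: "z * cnj z = 1" "z \<noteq> 0"
    using assms complex_norm_square[of z] by auto
  have "Im ?w = 0 \<longleftrightarrow> ?w = cnj ?w"
    by (metis Reals_cnj_iff complex_is_Real_iff)
  also have "\<dots> \<longleftrightarrow> z\<^sup>2 * ?w = z\<^sup>2 * cnj ?w"
    using z by simp
  also have "z\<^sup>2 * cnj ?w = (a - z) * (b - z)"
    using z by simp algebra
  also have "z\<^sup>2 * ?w = (a - z) * (b - z) \<longleftrightarrow> z\<^sup>2 * ?w - (a - z) * (b - z) = 0"
    by simp
  also have "z\<^sup>2 * ?w - (a - z) * (b - z)
      = cnj a * cnj b * z ^ 4 + - (cnj a + cnj b) * z ^ 3 + 0 * z\<^sup>2 + (a + b) * z + - (a * b)"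
    by algebra
  finally show ?thesis .
qed

text \<open>Equal directed angles make \<open>(a - z) * (b - z) / (W - z)\<^sup>2\<close> a positive
  real. As \<open>W\<close> lies on the diameter, \<open>W - z\<close> is a real multiple of
  \<open>z\<close>, so \<open>(a - z) * (b - z) / z\<^sup>2\<close> is real too, and on the circle
  this is the conjugate of the product in question.\<close>

lemma alhazen_solution_Im:
  assumes "1 < cmod a" "1 < cmod b" "alhazen_solution a b z"
  shows "cmod z = 1" and "Im ((cnj a * z - 1) * (cnj b * z - 1)) = 0"
proof -
  show unit: "cmod z = 1"
    using assms(3) by (simp add: alhazen_solution_def)
  obtain W where W: "W \<in> affine hull {0, z}" "W \<noteq> z" "directed_angle a z W = directed_angle W z b"
    using assms(3) by (auto simp: alhazen_solution_def bisects_angle_def)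
  obtain s where s: "W = of_real s * z"
    using W(1) by (auto simp: affine_hull_2 scaleR_conv_of_real)
  have nz: "a - z \<noteq> 0" "b - z \<noteq> 0" "W - z \<noteq> 0"
    using assms unit W(2) by auto
  define p where "p = (W - z) / (a - z)"
  define q where "q = (b - z) / (W - z)"
  have pq: "p \<noteq> 0" "q \<noteq> 0" "Arg p = Arg q"
    using nz W(3) by (auto simp: p_def q_def directed_angle_def)
  have "q / p = of_real (cmod q / cmod p)"
    using pq rcis_cmod_Arg[of p] rcis_cmod_Arg[of q]
    by (metis cis_neq_zero mult_divide_mult_cancel_right of_real_divide rcis_def)
  then obtain r where "q / p = of_real r"
    by blast
  moreover have "q / p = (a - z) * (b - z) / (W - z)\<^sup>2"
    using nz by (simp add: p_def q_def power2_eq_square)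
  ultimately have "(a - z) * (b - z) = of_real r * (W - z)\<^sup>2"
    using nz by (simp add: field_simps)
  moreover have "W - z = of_real (s - 1) * z"
    by (simp add: s algebra_simps)
  ultimately have eq: "(a - z) * (b - z) = of_real (r * (s - 1)\<^sup>2) * z\<^sup>2"
    by (simp add: power_mult_distrib)
  have z: "z * cnj z = 1"
    using unit complex_norm_square[of z] by simp
  have "cnj ((cnj a * z - 1) * (cnj b * z - 1)) = (a - z) * (b - z) * (cnj z)\<^sup>2"
    using z by simp algebra
  also have "\<dots> = of_real (r * (s - 1)\<^sup>2) * (z * cnj z)\<^sup>2"
    unfolding eq by (simp add: power_mult_distrib)
  also have "\<dots> = of_real (r * (s - 1)\<^sup>2)"
    by (simp add: z)
  finally show "Im ((cnj a * z - 1) * (cnj b * z - 1)) = 0"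
    by (metis Im_complex_of_real complex_cnj_cnj complex_cnj_complex_of_real)
qed

context trisection_constructions
begin

text \<open>Together with three further roots on the circle, \<open>z\<close> exhausts the quartic.
  Its leading coefficient is nonzero, so Vieta's formulas give constructible symmetric functions,
  the second one being zero.\<close>

lemma pt_alhazen_solution:
  assumes ext: "1 < cmod a" "1 < cmod b" and pt: "pt a" "pt b" and z: "alhazen_solution a b z"
  shows "pt z"
proof -
  note unit = alhazen_solution_Im(1)[OF ext z] and Im_z = alhazen_solution_Im(2)[OF ext z]
  obtain A where A: "A \<subseteq> sphere 0 1" "card A = 4"
    "\<And>x. x \<in> A \<Longrightarrow> Im ((cnj a * x - 1) * (cnj b * x - 1)) = 0"
    using four_roots_on_unit_circle[OF ext] by blast
  \<comment> \<open>Whether or not \<open>z\<close> belongs to \<open>A\<close>, at least three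
    other roots remain.\<close>
  have "3 \<le> card (A - {z})"
    using A(2) by (simp add: card_Diff_singleton_if)
  then obtain B where B: "B \<subseteq> A - {z}" "card B = 3"
    by (metis obtain_subset_with_card_n)
  then obtain z2 z3 z4 where B_eq: "B = {z2, z3, z4}" and "z2 \<noteq> z3" "z2 \<noteq> z4" "z3 \<noteq> z4"
    by (auto simp: card_3_iff)
  with B(1) have dist: "distinct [z, z2, z3, z4]" and sub: "{z2, z3, z4} \<subseteq> A"
    by auto
  have circle: "cmod x = 1" if "x \<in> {z, z2, z3, z4}" for x
    using that unit sub A(1) by auto
  have "Im ((cnj a * x - 1) * (cnj b * x - 1)) = 0" if "x \<in> {z, z2, z3, z4}" for x
    using that Im_z sub A(3) by auto
  then have root: "\<forall>x\<in>{z, z2, z3, z4}. cnj a * cnj b * x ^ 4 + - (cnj a + cnj b) * x ^ 3 + 0 * x\<^sup>2 + (a + b) * x + - (a * b) = 0"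
    using circle unit_circle_quartic by blast
  note vieta = vieta_quartic[OF root dist]
  have k: "cnj a * cnj b \<noteq> 0" "pt (cnj a * cnj b)"
    using ext pt by (auto intro: pt_mult pt_cnj)
  have solve: "pt e" if "cnj a * cnj b * e = y" "pt y" for e y
    using that k by (metis nonzero_mult_div_cancel_left pt_divide)
  show ?thesis
  proof (rule pt_unit_quartic)
    show "pt (z + z2 + z3 + z4)"
      by (rule solve[OF vieta(1)]) (intro pt_minus pt_add pt_mult pt_cnj pt)
    show "z * z2 + z * z3 + z * z4 + z2 * z3 + z2 * z4 + z3 * z4 = 0"
      using vieta(2) k(1) by simp
    show "pt (z * z2 * z3 + z * z2 * z4 + z * z3 * z4 + z2 * z3 * z4)"
      by (rule solve[OF vieta(3)]) (intro pt_minus pt_add pt_mult pt_cnj pt)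
    show "pt (z * z2 * z3 * z4)"
      by (rule solve[OF vieta(4)]) (intro pt_minus pt_add pt_mult pt_cnj pt)
  qed (use circle in auto)
qed

end

section \<open>Compass, straightedge and trisection\<close>

text \<open>The two points of the first circle on the line of centres have distances
  \<open>\<bar>d - r\<bar>\<close> and \<open>\<bar>d + r\<bar>\<close> from \<open>Q\<close>, where
  \<open>d = dist P Q\<close>; these differ if \<open>d\<close> and \<open>r\<close> are positive.
  It supplies the distinctness that the circle-circle rule demands.\<close>

lemma sphere_inject:
  fixes P Q :: complex
  assumes "sphere P r = sphere Q s" "0 < r"
  shows "P = Q"
proof (rule ccontr)
  assume "P \<noteq> Q"
  define u where "u = sgn (Q - P)"
  have d: "Q - P = of_real (dist P Q) * u"
    using \<open>P \<noteq> Q\<close>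
    by (simp add: u_def sgn_div_norm dist_norm norm_minus_commute scaleR_conv_of_real)
  have u: "cmod u = 1"
    using \<open>P \<noteq> Q\<close> by (simp add: u_def norm_sgn)
  have "P + of_real t * u \<in> sphere Q s" if "\<bar>t\<bar> = r" for t
    using that u by (simp add: assms(1)[symmetric] dist_norm norm_mult)
  then have "\<bar>dist P Q - t\<bar> = s" if "\<bar>t\<bar> = r" for t
  proof -
    have "Q - (P + of_real t * u) = of_real (dist P Q - t) * u"
      by (simp only: of_real_diff left_diff_distrib d diff_diff_eq[symmetric])
    then have "dist Q (P + of_real t * u) = cmod (of_real (dist P Q - t) * u)"
      by (simp only: dist_norm)
    also have "\<dots> = \<bar>dist P Q - t\<bar>"
      unfolding norm_mult u by (simp del: of_real_diff)
    finally show ?thesis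
      using \<open>\<And>t. \<bar>t\<bar> = r \<Longrightarrow> P + of_real t * u \<in> sphere Q s\<close>[OF that] by simp
  qed
  from this[of r] this[of "- r"] show False
    using \<open>0 < r\<close> \<open>P \<noteq> Q\<close> zero_less_dist_iff[of P Q] by linarith
qed

lemma euclid_on_line_circle:
  assumes "euclid_tri_point S A" "euclid_tri_point S B" "A \<noteq> B"
    and "euclid_tri_point S P" "euclid_tri_point S Q" "euclid_tri_point S R" "Q \<noteq> R"
    and "X = A + of_real t * (B - A)" "dist P X = dist Q R"
  shows "euclid_tri_point S X"
  using euclid_tri_line_circle[OF euclid_tri_straightedge[OF assms(1-3)] euclid_tri_compass[OF assms(4-7)]]
    affine_combination_mem_hull[OF assms(8)] assms(9) by simp

lemma euclid_on_circles:
  assumes "euclid_tri_point S P" "euclid_tri_point S Q" "euclid_tri_point S R" "Q \<noteq> R"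
    and "euclid_tri_point S P'" "euclid_tri_point S Q'" "euclid_tri_point S R'" "Q' \<noteq> R'"
    and "P \<noteq> P'" "dist P X = dist Q R" "dist P' X = dist Q' R'"
  shows "euclid_tri_point S X"
proof (rule euclid_tri_circle_circle)
  show "euclid_tri_circle S (sphere P (dist Q R))" "euclid_tri_circle S (sphere P' (dist Q' R'))"
    using assms by (auto intro: euclid_tri_compass)
  show "sphere P (dist Q R) \<noteq> sphere P' (dist Q' R')"
    using sphere_inject[of P "dist Q R"] assms(4,9) by auto
qed (use assms in auto)

lemma euclid_line_constructions:
  assumes "0 \<in> S" "1 \<in> S"
  shows "line_constructions (euclid_tri_point S) (euclid_tri_line S)"
proof -
  let ?E = "euclid_tri_point S"
  have zero: "?E 0" and one: "?E 1"
    using assms euclid_tri_given by auto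
  have uminus: "?E (- P)" if "?E P" for P
  proof (cases "P = 0")
    case False
    then show ?thesis
      using that zero euclid_on_line_circle[of S 0 P 0 0 P "- P" "-1"] by simp
  qed (use zero in simp)
  have double: "?E (P + P)" if "?E P" for P
  proof (cases "P = 0")
    case False
    then show ?thesis
      using that zero euclid_on_line_circle[of S 0 P P 0 P "P + P" 2] by (simp add: dist_norm)
  qed (use zero in simp)
  have add: "?E (P + Q)" if "?E P" "?E Q" for P Q
  proof -
    consider "P = 0" | "Q = 0" | "P = Q" | "P \<noteq> 0" "Q \<noteq> 0" "P \<noteq> Q"
      by blast
    then show ?thesis
    proof cases
      \<comment> \<open>Fourth vertex of a parallelogram: \<open>P + Q\<close> has distance
        \<open>\<bar>Q\<bar>\<close> from \<open>P\<close> and \<open>\<bar>P\<bar>\<close> from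
        \<open>Q\<close>. The earlier cases are those of a vanishing radius or of equal
        centres.\<close>
      case 4
      then show ?thesis
        using that zero euclid_on_circles[of S P 0 Q Q 0 P "P + Q"] by (simp add: dist_norm)
    qed (use that double in auto)
  qed
  \<comment> \<open>The circles about \<open>0\<close> and \<open>1\<close> through \<open>P\<close>
    also pass through \<open>cnj P\<close>; if \<open>P\<close> is one of the centres, it is its own
    conjugate.\<close>
  have cnj: "?E (cnj P)" if "?E P" for P
  proof -
    have "dist 1 (cnj P) = dist 1 P"
      using complex_mod_cnj[of "1 - P"] by (simp add: dist_norm)
    then show ?thesis
      using that zero one euclid_on_circles[of S 0 0 P 1 1 P "cnj P"]
      by (cases "P = 0 \<or> P = 1") auto
  qed
  have two: "?E 2"
    using double[OF one] by simp
  have ii: "?E \<i>"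
  proof -
    \<comment> \<open>Apex of the equilateral triangle on \<open>- 1\<close> and \<open>1\<close>,
      which provides the imaginary axis; the unit circle then cuts out \<open>\<i>\<close>.\<close>
    let ?J = "\<i> * of_real (sqrt 3)"
    have J: "?E ?J"
    proof (rule euclid_on_circles)
      show "?E 1" "?E 0" "?E 2" "?E (- 1)" "?E 0" "?E 2"
        using zero one two uminus by auto
      show "dist 1 ?J = dist 0 (2 :: complex)" "dist (- 1) ?J = dist 0 (2 :: complex)"
        by (simp_all add: dist_norm cmod_def)
    qed auto
    show ?thesis
      using J zero one euclid_on_line_circle[of S 0 ?J 0 0 1 \<i> "1 / sqrt 3"] by simp
  qed
  have ii_mult: "?E (\<i> * of_real y)" if "?E (of_real y)" for y
    using that zero ii euclid_on_line_circle[of S 0 \<i> 0 0 "of_real y" "\<i> * of_real y" y]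
    by (cases "y = 0") (auto simp: norm_mult)
  have mult_ii: "?E (of_real y)" if "?E (\<i> * of_real y)" for y
    using that zero one euclid_on_line_circle[of S 0 1 0 0 "\<i> * of_real y" "of_real y" y]
    by (cases "y = 0") (auto simp: norm_mult)
  have Re: "?E (of_real (Re P))" if "?E P" for P
  proof (cases "Im P = 0")
    case True
    then have "of_real (Re P) = P"
      by (simp add: complex_eq_iff)
    then show ?thesis
      using that by simp
  next
    case False
    then have "P \<noteq> cnj P"
      by (auto simp: complex_eq_iff)
    then have l: "euclid_tri_line S (affine hull {P, cnj P})"
      using that cnj by (auto intro: euclid_tri_straightedge)
    have m: "euclid_tri_line S (affine hull {0, 1})"
      using zero one by (auto intro: euclid_tri_straightedge)
    have "P \<in> affine hull {P, cnj P}"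
      by (simp add: hull_inc)
    moreover have "P \<notin> affine hull {0, 1}"
      using False by (auto simp: affine_hull_2)
    ultimately have neq: "affine hull {P, cnj P} \<noteq> affine hull {0, 1}"
      by blast
    show ?thesis
    proof (rule euclid_tri_line_line[OF l m neq])
      show "of_real (Re P) \<in> affine hull {P, cnj P}"
        by (rule affine_combination_mem_hull[of _ _ "1 / 2"]) (simp add: complex_eq_iff)
      show "of_real (Re P) \<in> affine hull {0, 1 :: complex}"
        by (rule affine_combination_mem_hull[of _ _ "Re P"]) simp
    qed
  qed
  show ?thesis
  proof
    show "?E X" if "euclid_tri_line S l" "euclid_tri_line S m" "X \<in> l" "X \<in> m" "Y \<in> l" "Y \<notin> m" for l m X Y
      using that euclid_tri_line_line by metis
    show "?E (Complex x y) \<longleftrightarrow> ?E (of_real x) \<and> ?E (of_real y)" for x y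
    proof
      assume xy: "?E (Complex x y)"
      then have x: "?E (of_real x)"
        using Re by fastforce
      have "Complex x y + - of_real x = \<i> * of_real y"
        by (simp add: complex_eq_iff)
      then have "?E (\<i> * of_real y)"
        using add[OF xy uminus[OF x]] by (simp only:)
      then show "?E (of_real x) \<and> ?E (of_real y)"
        using x mult_ii by blast
    next
      assume "?E (of_real x) \<and> ?E (of_real y)"
      then show "?E (Complex x y)"
        unfolding Complex_eq using add ii_mult by blast
    qed
  qed (use one add uminus euclid_tri_straightedge in auto)
qed

lemma euclid_trisection_constructions:
  assumes "0 \<in> S" "1 \<in> S"
  shows "trisection_constructions (euclid_tri_point S) (euclid_tri_line S)"
proof -
  let ?E = "euclid_tri_point S"
  interpret line_constructions ?E "euclid_tri_line S"
    using assms by (rule euclid_line_constructions)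
  \<comment> \<open>Geometric mean: the circle with diameter from \<open>- 1\<close> to
    \<open>x\<close> meets the imaginary axis at height \<open>sqrt x\<close>.\<close>
  have sqrt: "?E (of_real (sqrt x))" if x: "?E (of_real x)" "0 < x" for x
  proof -
    have "?E ((of_real x - 1) / 2)"
      using x by (simp only: pt_field)
    then have centre: "?E (of_real ((x - 1) / 2))"
      by simp
    have "?E (\<i> * of_real (sqrt x))"
    proof (rule euclid_on_line_circle)
      show "?E 0" "?E \<i>" "?E (of_real ((x - 1) / 2))" "?E (of_real ((x - 1) / 2))" "?E (- 1)"
        using centre by (simp_all only: pt_field)
      show "of_real ((x - 1) / 2) \<noteq> (- 1 :: complex)"
        using x(2) by (simp add: complex_eq_iff)
      show "\<i> * of_real (sqrt x) = 0 + of_real (sqrt x) * (\<i> - 0)"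
        by simp
      have "((x - 1) / 2)\<^sup>2 + (sqrt x)\<^sup>2 = ((x - 1) / 2 + 1)\<^sup>2"
        using x(2) by (simp add: power2_eq_square field_simps)
      moreover have "of_real ((x - 1) / 2) - (- 1) = (of_real ((x - 1) / 2 + 1) :: complex)"
        by simp
      ultimately show "dist (of_real ((x - 1) / 2)) (\<i> * of_real (sqrt x)) = dist (of_real ((x - 1) / 2)) (- 1 :: complex)"
        unfolding dist_norm by (simp only: norm_of_real) (simp add: cmod_def)
    qed auto
    then show ?thesis
      using coords[of 0 "sqrt x"] by (simp add: Complex_eq)
  qed
  \<comment> \<open>The bound \<psi> < \<open>pi / 3\<close> keeps the angle
    \<open>3 * \<psi>\<close> below \<open>pi\<close>, as the trisection rule requires.\<close>
  have third: "?E (cis \<psi>)" if "?E (cis \<psi> ^ 3)" "0 \<le> \<psi>" "\<psi> < pi / 3" for \<psi>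
  proof (cases "\<psi> = 0")
    case False
    have "?E (cis (3 * \<psi>))"
      using that(1) by (simp add: Complex.DeMoivre)
    then have "euclid_tri_line S (affine hull {0, 0 + cis 0})"
      "euclid_tri_line S (affine hull {0, 0 + cis (3 * \<psi>)})"
      using pt_zero pt_one by (auto intro!: line)
    then have l: "euclid_tri_line S (affine hull {0, 0 + cis \<psi>})"
      by (rule euclid_tri_trisect[where \<alpha> = 0 and \<beta> = "3 * \<psi>"]) (use that False in auto)
    have c: "euclid_tri_circle S (sphere 0 (dist 0 (1 :: complex)))"
      using euclid_tri_compass[OF pt_zero pt_zero pt_one] by simp
    show ?thesis
      by (rule euclid_tri_line_circle[OF l c]) (auto intro: hull_inc)
  qed (simp add: pt_one)
  have "?E w" if w: "cmod w = 1" "?E (w ^ 3)" for w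
  proof -
    \<comment> \<open>Rotating back by \<open>k\<close> steps of the constructible sixth root of
      unity brings the argument of \<open>w\<close> into the range of \<open>third\<close>.\<close>
    define \<zeta> where "\<zeta> = cis (pi / 3)"
    define k where "k = nat \<lfloor>Arg2pi w / (pi / 3)\<rfloor>"
    define \<psi> where "\<psi> = Arg2pi w - k * (pi / 3)"
    have "\<zeta> = (1 + \<i> * of_real (sqrt 3)) / 2"
      by (simp add: \<zeta>_def complex_eq_iff cos_60 sin_60)
    moreover have "?E (of_real (sqrt 3))"
      using sqrt[of 3] pt_numeral by simp
    ultimately have z: "?E \<zeta>"
      by (simp only: pt_field)
    have k: "real k = of_int \<lfloor>Arg2pi w / (pi / 3)\<rfloor>"
      using Arg2pi_ge_0[of w] by (simp add: k_def)
    have "real k \<le> Arg2pi w / (pi / 3)" "Arg2pi w / (pi / 3) < real k + 1"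
      unfolding k by linarith+
    then have psi: "0 \<le> \<psi>" "\<psi> < pi / 3"
      by (simp_all add: \<psi>_def field_simps)
    have "cis \<psi> * \<zeta> ^ k = cis (Arg2pi w)"
      by (simp add: \<psi>_def \<zeta>_def Complex.DeMoivre cis_mult)
    also have "\<dots> = w"
      using Arg2pi_eq[of w] w(1) by (simp add: cis_conv_exp)
    finally have w_eq: "w = cis \<psi> * \<zeta> ^ k" ..
    have "cis \<psi> ^ 3 = w ^ 3 / (\<zeta> ^ k) ^ 3"
      by (simp add: w_eq power_mult_distrib \<zeta>_def)
    moreover have "?E \<dots>"
      using w(2) z by (simp only: pt_field)
    ultimately have "?E (cis \<psi>)"
      using third psi by simp
    then show ?thesis
      unfolding w_eq using z by (simp only: pt_field)
  qed
  with sqrt show ?thesis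
    by unfold_locales
qed

section \<open>Origami\<close>

text \<open>The implicit equation with normal vector \<open>(p, q)\<close> makes folds and
  reflections explicit calculations; the set is a line only if \<open>(p, q)\<close> is
  nonzero.\<close>

definition coord_line :: "real \<Rightarrow> real \<Rightarrow> real \<Rightarrow> complex set" where
  "coord_line p q c = {X. p * Re X + q * Im X = c}"

lemma affine_hull_coord_line:
  fixes A B :: complex
  assumes "A \<noteq> B"
  shows "affine hull {A, B} =
    coord_line (Im A - Im B) (Re B - Re A) (Im A * Re B - Re A * Im B)"
proof
  show "affine hull {A, B} \<subseteq> coord_line (Im A - Im B) (Re B - Re A) (Im A * Re B - Re A * Im B)"
  proof
    fix X
    assume "X \<in> affine hull {A, B}"
    then obtain u v where X: "X = u *\<^sub>R A + v *\<^sub>R B" and "u + v = 1"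
      by (auto simp: affine_hull_2)
    then have v: "v = 1 - u"
      by simp
    show "X \<in> coord_line (Im A - Im B) (Re B - Re A) (Im A * Re B - Re A * Im B)"
      by (simp add: coord_line_def X v algebra_simps)
  qed
  show "coord_line (Im A - Im B) (Re B - Re A) (Im A * Re B - Re A * Im B) \<subseteq> affine hull {A, B}"
  proof
    fix X
    assume "X \<in> coord_line (Im A - Im B) (Re B - Re A) (Im A * Re B - Re A * Im B)"
    then have X: "(Re X - Re A) * (Im B - Im A) = (Im X - Im A) * (Re B - Re A)"
      by (simp add: coord_line_def algebra_simps)
    show "X \<in> affine hull {A, B}"
    proof (cases "Re A = Re B")
      case True
      then have "Im A \<noteq> Im B"
        using assms by (auto simp: complex_eq_iff)
      with X True show ?thesis
        by (intro affine_combination_mem_hull[of _ _ "(Im X - Im A) / (Im B - Im A)"])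
          (auto simp: complex_eq_iff)
    next
      case False
      then have "(Im X - Im A) = (Re X - Re A) / (Re B - Re A) * (Im B - Im A)"
        using X by (simp add: divide_simps)
      with False show ?thesis
        by (intro affine_combination_mem_hull[of _ _ "(Re X - Re A) / (Re B - Re A)"])
          (simp add: complex_eq_iff)
    qed
  qed
qed

lemma is_line_coord_line:
  assumes "p \<noteq> 0 \<or> q \<noteq> 0"
  shows "is_line (coord_line p q c)"
proof -
  define n where "n = p\<^sup>2 + q\<^sup>2"
  have n: "n \<noteq> 0"
    using assms by (simp add: n_def sum_power2_eq_zero_iff)
  define A where "A = Complex (p * c / n) (q * c / n)"
  define B where "B = A + Complex (- q) p"
  have "A \<noteq> B"
    using assms by (auto simp: B_def complex_eq_iff)
  moreover have "Im A * Re B - Re A * Im B = - c"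
  proof -
    have "p * Re A + q * Im A = c * n / n"
      by (simp add: A_def n_def power2_eq_square add_divide_distrib algebra_simps)
    then show ?thesis
      using n by (simp add: B_def algebra_simps)
  qed
  then have "coord_line p q c = coord_line (Im A - Im B) (Re B - Re A) (Im A * Re B - Re A * Im B)"
    by (auto simp: coord_line_def B_def)
  ultimately show ?thesis
    unfolding is_line_def using affine_hull_coord_line by metis
qed

text \<open>\<open>M\<close> is the foot of the perpendicular. For every \<open>Z\<close> on the
  line, \<open>P - Z\<close> has the same inner product \<open>e\<close> with the normal vector, so
  Cauchy-Schwarz bounds its length below by the length attained at \<open>M\<close>.\<close>

lemma line_reflection_coord_line:
  assumes "p \<noteq> 0 \<or> q \<noteq> 0"
  shows "line_reflection (coord_line p q c) P =
    P - of_real (2 * (p * Re P + q * Im P - c) / (p\<^sup>2 + q\<^sup>2)) * Complex p q"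
proof -
  define n where "n = p\<^sup>2 + q\<^sup>2"
  have n: "n > 0"
    using assms by (simp add: n_def sum_power2_gt_zero_iff)
  define e where "e = p * Re P + q * Im P - c"
  define M where "M = P - of_real (e / n) * Complex p q"
  obtain A B where AB: "coord_line p q c = affine hull {A, B}"
    using is_line_coord_line[OF assms] is_line_def by blast
  have norm_n: "cmod (Complex p q) = sqrt n"
    by (simp add: cmod_def n_def)
  have "M = closest_point (coord_line p q c) P"
  proof (rule closest_point_unique)
    show "convex (coord_line p q c)" "closed (coord_line p q c)"
      unfolding AB by (auto intro: affine_imp_convex)
    have "p * Re M + q * Im M = c"
    proof -
      have "p * Re M + q * Im M = p * Re P + q * Im P - e / n * (p\<^sup>2 + q\<^sup>2)"
        by (simp add: M_def algebra_simps power2_eq_square)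
      also have "\<dots> = c"
        using n by (simp add: e_def flip: n_def)
      finally show ?thesis .
    qed
    then show "M \<in> coord_line p q c"
      by (simp add: coord_line_def)
    show "\<forall>Z\<in>coord_line p q c. dist P M \<le> dist P Z"
    proof
      fix Z
      assume "Z \<in> coord_line p q c"
      then have "inner (P - Z) (Complex p q) = e"
        by (simp add: coord_line_def e_def inner_complex_def algebra_simps)
      then have "\<bar>e\<bar> \<le> cmod (P - Z) * sqrt n"
        using Cauchy_Schwarz_ineq2[of "P - Z" "Complex p q"] norm_n by simp
      moreover have "dist P M = \<bar>e\<bar> / n * sqrt n"
        using n by (simp add: M_def dist_norm norm_mult norm_n norm_divide)
      moreover have "\<bar>e\<bar> / n * sqrt n = \<bar>e\<bar> / sqrt n"
        using n real_div_sqrt[of n] by (simp add: field_simps)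
      ultimately show "dist P M \<le> dist P Z"
        using n by (simp add: dist_norm pos_divide_le_eq)
    qed
  qed
  then have "line_reflection (coord_line p q c) P = 2 * M - P"
    by (simp only: line_reflection_def)
  then show ?thesis
    by (simp add: M_def e_def n_def algebra_simps)
qed

lemma origami_coord_meet:
  assumes "origami_line S (coord_line p q c)" "origami_line S (coord_line p' q' c')" "p * q' \<noteq> q * p'"
    and "p * Re X + q * Im X = c" "p' * Re X + q' * Im X = c'"
  shows "origami_point S X"
proof (rule origami_P)
  show "X \<in> coord_line p q c" "X \<in> coord_line p' q' c'"
    using assms(4,5) by (auto simp: coord_line_def)
  have "X + Complex (- q) p \<in> coord_line p q c" "X + Complex (- q) p \<notin> coord_line p' q' c'"
    using assms(3-5) by (auto simp: coord_line_def algebra_simps)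
  then show "coord_line p q c \<noteq> coord_line p' q' c'"
    by blast
qed (use assms in auto)

text \<open>A fold perpendicular to a line maps that line to itself, so (E) drops perpendiculars as
  soon as a constructed point of the line other than \<open>Q\<close> is available.\<close>

lemma origami_perpendicular:
  assumes "origami_line S (coord_line p q c)" "origami_point S P" "P \<in> coord_line p q c"
    and "origami_point S Q" "P \<noteq> Q" "p \<noteq> 0 \<or> q \<noteq> 0"
  shows "origami_line S (coord_line q (- p) (q * Re Q - p * Im Q))"
proof (rule origami_E[OF assms(1,2,4,5)])
  show "is_line (coord_line q (- p) (q * Re Q - p * Im Q))"
    using assms(6) by (intro is_line_coord_line) auto
  show "Q \<in> coord_line q (- p) (q * Re Q - p * Im Q)"
    by (simp add: coord_line_def)
  have "q \<noteq> 0 \<or> - p \<noteq> 0"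
    using assms(6) by auto
  from line_reflection_coord_line[OF this] obtain k
    where k: "line_reflection (coord_line q (- p) (q * Re Q - p * Im Q)) P = P - of_real k * Complex q (- p)"
    by blast
  show "line_reflection (coord_line q (- p) (q * Re Q - p * Im Q)) P \<in> coord_line p q c"
    unfolding k using assms(3) by (simp add: coord_line_def algebra_simps)
qed

lemma origami_line_constructions:
  assumes "0 \<in> S" "1 \<in> S"
  shows "line_constructions (origami_point S) (origami_line S)"
proof -
  let ?O = "origami_point S" and ?L = "\<lambda>p q c. origami_line S (coord_line p q c)"
  have zero: "?O 0" and one: "?O 1"
    using assms origami_given by auto
  have real_axis: "?L 0 1 0"
    using origami_L[OF zero one] by (simp add: affine_hull_coord_line)
  have vertical: "?L 1 0 (Re Q)" if "?O Q" for Q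
  proof -
    obtain P where "?O P" "P \<noteq> Q" "P \<in> coord_line 0 1 0"
      using zero one by (cases "Q = 0") (auto simp: coord_line_def)
    then show ?thesis
      using origami_perpendicular[OF real_axis, of P Q] that by simp
  qed
  have imag_axis: "?L 1 0 0"
    using vertical[OF zero] by simp
  \<comment> \<open>The perpendicular is dropped on the imaginary axis from the base point
    \<open>0\<close>, so \<open>Q = 0\<close> needs the real axis itself.\<close>
  have horizontal: "?L 0 1 (Im Q)" if "?O Q" for Q
  proof (cases "Q = 0")
    case False
    then have "?L 0 (- 1) (- Im Q)"
      using origami_perpendicular[OF imag_axis zero, of Q] that by (simp add: coord_line_def)
    then show ?thesis
      by (simp add: coord_line_def)
  qed (use real_axis in simp)
  \<comment> \<open>The two folds through \<open>0\<close> that bring \<open>1\<close> to the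
    imaginary axis: this one puts it at \<open>\<i>\<close>, the antidiagonal at
    \<open>- \<i>\<close>.\<close>
  have diagonal: "?L 1 (- 1) 0"
    by (rule origami_E[OF imag_axis one zero])
      (auto intro: is_line_coord_line simp: line_reflection_coord_line, auto simp: coord_line_def)
  have antidiagonal: "?L 1 1 0"
    by (rule origami_E[OF imag_axis one zero])
      (auto intro: is_line_coord_line simp: line_reflection_coord_line, auto simp: coord_line_def)
  have corner: "?O (Complex (Re P) (Im Q))" if "?O P" "?O Q" for P Q
    by (rule origami_coord_meet[OF vertical[OF that(1)] horizontal[OF that(2)]]) auto
  have Re: "?O (of_real (Re P))" if "?O P" for P
    using corner[OF that zero] by (simp add: Complex_eq)
  have diag: "?O (Complex x x)" if "?O (of_real x)" for x
    by (rule origami_coord_meet[OF vertical[OF that] diagonal]) auto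
  have diag': "?O (Complex x x)" if "?O (Complex 0 x)" for x
    by (rule origami_coord_meet[OF horizontal[OF that] diagonal]) auto
  have antidiag: "?O (Complex x (- x))" if "?O (of_real x)" for x
    by (rule origami_coord_meet[OF vertical[OF that] antidiagonal]) auto
  have minus: "?O (of_real (- x))" if "?O (of_real x)" for x
  proof -
    have "?O (Complex 0 (- x))"
      using corner[OF zero antidiag[OF that]] by simp
    from Re[OF diag'[OF this]] show ?thesis
      by simp
  qed
  \<comment> \<open>The perpendicular to the diagonal through \<open>Complex x y\<close> meets the
    real axis at \<open>x + y\<close>. The auxiliary \<open>P\<close> is a point of the diagonal
    chosen to differ from \<open>Complex x y\<close>.\<close>
  have add: "?O (of_real (x + y))" if "?O (Complex x y)" for x y
  proof -
    define P where "P = (if Complex x y = 0 then Complex 1 1 else 0)"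
    have "?O P" "P \<noteq> Complex x y" "P \<in> coord_line 1 (- 1) 0"
      using zero diag[of 1] one by (auto simp: P_def coord_line_def complex_eq_iff)
    then have "?L (- 1) (- 1) (- x - y)"
      using origami_perpendicular[OF diagonal, of P "Complex x y"] that by simp
    then show ?thesis
      by (rule origami_coord_meet[OF _ real_axis]) auto
  qed
  show ?thesis
  proof
    show "?O X" if "origami_line S l" "origami_line S m" "X \<in> l" "X \<in> m" "Y \<in> l" "Y \<notin> m" for l m X Y
      using that origami_P by metis
    show coords: "?O (Complex x y) \<longleftrightarrow> ?O (of_real x) \<and> ?O (of_real y)" for x y
    proof
      assume xy: "?O (Complex x y)"
      have "?O (Complex 0 y)"
        using corner[OF zero xy] by simp
      from Re[OF xy] Re[OF diag'[OF this]] show "?O (of_real x) \<and> ?O (of_real y)"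
        by simp
    next
      assume "?O (of_real x) \<and> ?O (of_real y)"
      then show "?O (Complex x y)"
        using corner[OF _ diag, of "of_real x" y] by simp
    qed
    show "?O (of_real (x + y))" if "?O (of_real x)" "?O (of_real y)" for x y
      using that coords add by blast
  qed (use one minus origami_L in auto)
qed

lemma origami_trisection_constructions:
  assumes "0 \<in> S" "1 \<in> S"
  shows "trisection_constructions (origami_point S) (origami_line S)"
proof -
  let ?O = "origami_point S" and ?L = "\<lambda>p q c. origami_line S (coord_line p q c)"
  interpret line_constructions ?O "origami_line S"
    using assms by (rule origami_line_constructions)
  have vertical: "?L 1 0 r" if "?O (of_real r)" for r
  proof -
    have "?O (of_real r + \<i>)"
      using that by (simp only: pt_field)
    then have "origami_line S (affine hull {of_real r + \<i>, of_real r})"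
      using that by (intro line) auto
    then show ?thesis
      by (simp add: affine_hull_coord_line)
  qed
  have sqrt: "?O (of_real (sqrt x))" if x: "?O (of_real x)" "0 < x" for x
  proof -
    have sq: "sqrt x * sqrt x = x"
      using x(2) by simp
    have "?O ((of_real x - 1) / 2)"
      using x by (simp only: pt_field)
    then have centre: "?O (of_real ((x - 1) / 2))"
      by simp
    have imag_axis: "?L 1 0 0"
      using vertical[of 0] pt_zero by simp
    txt \<open>The fold through the centre of the circle with diameter from \<open>- 1\<close> to \<open>x\<close> that puts \<open>- 1\<close> on
      the imaginary axis, namely at \<open>\<i> * sqrt x\<close>.\<close>
    have fold: "?L 1 (sqrt x) ((x - 1) / 2)"
    proof (rule origami_E[OF imag_axis pt_minus[OF pt_one] centre])
      show "- 1 \<noteq> complex_of_real ((x - 1) / 2)"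
        using x(2) by (auto simp: complex_eq_iff)
      have "- 2 * ((x + 1) / 2) / (1 + x) = - 1"
        using x(2) by (simp add: field_simps)
      then show "line_reflection (coord_line 1 (sqrt x) ((x - 1) / 2)) (- 1) \<in> coord_line 1 0 0"
        using x(2) by (subst line_reflection_coord_line) (simp_all add: coord_line_def field_simps)
    qed (auto simp: is_line_coord_line, simp add: coord_line_def)
    \<comment> \<open>The fold contains the midpoint of \<open>- 1\<close> and its image
      \<open>\<i> * sqrt x\<close>; it is found on the vertical line at
      \<open>- 1 / 2\<close>.\<close>
    have "?O (- 1 / 2)"
      by (simp only: pt_field)
    then have "?L 1 0 (- 1 / 2)"
      using vertical[of "- 1 / 2"] by simp
    then have "?O (Complex (- 1 / 2) (sqrt x / 2))"
      by (rule origami_coord_meet[OF fold]) (use x(2) sq in \<open>auto simp: field_simps\<close>)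
    then have "?O (of_real (sqrt x / 2))"
      using coords by blast
    then have "?O (of_real (sqrt x / 2) * 2)"
      by (simp only: pt_field)
    then show ?thesis
      by simp
  qed
  have "?O w" if w: "cmod w = 1" "?O (w ^ 3)" for w
  proof -
    define c where "c = Re w"
    define d where "d = Im w"
    have cd: "c\<^sup>2 + d\<^sup>2 = 1"
      using w(1) by (simp add: c_def d_def cmod_def)
    have w_eq: "w = Complex c d"
      by (simp add: c_def d_def)
    \<comment> \<open>The fold below divides by \<open>c\<close>, and for \<open>d = 0\<close> it
      would be parallel to the vertical line that cuts it; in both cases \<open>w\<close> is a power
      of \<open>\<i>\<close>.\<close>
    consider "c = 0" | "d = 0" | "c \<noteq> 0" "d \<noteq> 0"
      by blast
    then show ?thesis
    proof cases
      case 1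
      then have "d = 1 \<or> d = - 1"
        using cd by (simp add: power2_eq_1_iff)
      with 1 show ?thesis
        unfolding w_eq using coords pt_zero pt_one pt_minus[OF pt_one] by auto
    next
      case 2
      then have "c = 1 \<or> c = - 1"
        using cd by (simp add: power2_eq_1_iff)
      with 2 show ?thesis
        unfolding w_eq using coords pt_zero pt_one pt_minus[OF pt_one] by auto
    next
      case 3
      have "w \<noteq> 0"
        using w(1) by auto
      have l: "origami_line S (affine hull {0, w ^ 3})"
        using line[OF pt_zero w(2)] \<open>w \<noteq> 0\<close> by simp
      have d2: "d * d = 1 - c * c"
        using cd by (simp add: power2_eq_square)
      have refl: "line_reflection (coord_line c d (1 / (4 * c))) P
          = P - of_real (2 * (c * Re P + d * Im P - 1 / (4 * c))) * Complex c d" for P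
        using 3 cd by (simp add: line_reflection_coord_line)
      txt \<open>The fold that takes \<open>0\<close> to \<open>w / (2 * c)\<close> and \<open>1\<close> to \<open>- (w ^ 3) / (2 * c)\<close>.\<close>
      have fold: "?L c d (1 / (4 * c))"
      proof (rule origami_T[OF pt_zero pt_one _ l])
        show "is_line (coord_line c d (1 / (4 * c)))"
          using 3 by (simp add: is_line_coord_line)
        show "0 \<in> affine hull {0, w ^ 3}"
          by (simp add: hull_inc)
        have w3: "w ^ 3 = Complex (c * (4 * (c * c) - 3)) (d * (4 * (c * c) - 1))"
        proof -
          have "w ^ 3 = Complex (c * (c * c) - 3 * c * (d * d)) (3 * (c * c) * d - d * (d * d))"
            by (simp add: w_eq complex_eq_iff power3_eq_cube algebra_simps)
          then show ?thesis
            unfolding d2 by (simp add: algebra_simps)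
        qed
        show "line_reflection (coord_line c d (1 / (4 * c))) 1 \<in> affine hull {0, w ^ 3}"
          unfolding refl w3
          by (rule affine_combination_mem_hull[of _ _ "- 1 / (2 * c)"])
            (use 3 in \<open>simp add: complex_eq_iff field_simps\<close>)
        have "line_reflection (coord_line c d (1 / (4 * c))) 0 = Complex (1 / 2) (d / (2 * c))"
          unfolding refl using 3 by (simp add: complex_eq_iff field_simps)
        then show "line_reflection (coord_line c d (1 / (4 * c))) 0 \<in> perp_bisector 0 1"
          by (simp add: perp_bisector_def dist_norm cmod_def power2_eq_square)
      qed simp
      \<comment> \<open>The midpoint of \<open>0\<close> and its image \<open>w / (2 * c)\<close>
        lies on the fold and has real part \<open>1 / 4\<close>.\<close>
      have "?O (1 / 4)"
        by (simp only: pt_field)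
      then have "?L 1 0 (1 / 4)"
        using vertical[of "1 / 4"] by simp
      then have "?O (Complex (1 / 4) (d / (4 * c)))"
        by (rule origami_coord_meet[OF fold]) (use 3 d2 in \<open>auto simp: field_simps\<close>)
      then have "?O (of_real (d / (4 * c)))"
        using coords by blast
      then have "?O (of_real (d / (4 * c)) * 4)"
        by (simp only: pt_field)
      then have t: "?O (of_real (d / c))"
        by simp
      \<comment> \<open>From the tangent \<open>d / c\<close> back to the cosine by
        \<open>1 / (1 + tan\<^sup>2) = cos\<^sup>2\<close>; the square root gives \<open>c\<close>
        up to sign.\<close>
      then have "?O (inverse (1 + (of_real (d / c))\<^sup>2))"
        by (simp only: pt_field)
      moreover have "inverse (1 + (d / c)\<^sup>2) = c\<^sup>2"
        using 3 cd by (simp add: field_simps)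
      then have "inverse (1 + (of_real (d / c))\<^sup>2) = complex_of_real (c\<^sup>2)"
        by (metis of_real_1 of_real_add of_real_inverse of_real_power)
      ultimately have "?O (of_real (c\<^sup>2))"
        by simp
      then have "?O (of_real \<bar>c\<bar>)"
        using sqrt[of "c\<^sup>2"] 3 by simp
      then have c: "?O (of_real c)"
        using pt_minus[of "of_real (- c)"] by (simp add: abs_if split: if_splits)
      have "?O (of_real (d / c) * of_real c)"
        using t c by (simp only: pt_field)
      then have "?O (of_real d)"
        using 3 by simp
      with c show ?thesis
        unfolding w_eq using coords by blast
    qed
  qed
  with sqrt show ?thesis
    by unfold_locales
qed

theorem theorem5p3:
  fixes a b :: complex
  assumes "norm a > 1" and "norm b > 1"
  shows "(\<forall>z. alhazen_solution a b z \<longrightarrow> euclid_tri_point {0, 1, a, b} z) \<and>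
         (\<forall>z. alhazen_solution a b z \<longrightarrow> origami_point {0, 1, a, b} z)"
proof -
  let ?S = "{0, 1, a, b}"
  interpret euclid: trisection_constructions "euclid_tri_point ?S" "euclid_tri_line ?S"
    by (rule euclid_trisection_constructions) simp_all
  interpret origami: trisection_constructions "origami_point ?S" "origami_line ?S"
    by (rule origami_trisection_constructions) simp_all
  have "euclid_tri_point ?S a" "euclid_tri_point ?S b" "origami_point ?S a" "origami_point ?S b"
    by (simp_all add: euclid_tri_given origami_given)
  then show ?thesis
    using euclid.pt_alhazen_solution[OF assms] origami.pt_alhazen_solution[OF assms] by blast
qed

end
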